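(* Let $d\in\mathbb{N}$ and let $\mathcal{F}$ be a family of compact connected subsets of $\mathbb{R}^d$ that has no finite hyperplane transversal. Suppose there exist a point $p\in\mathbb{R}^d$ and a ray $\vec{r}=\{p+tv\mid t\ge0\}$, $v\in\mathbb{S}^{d-1}$, such that for every $n\in\mathbb{N}$ the family $\{B\in\mathcal{F}\mid B\subset R(\vec{r},n)\}$ has no finite hyperplane transversal. Then there is a sequence $\{B_n\}_{n\in\mathbb{N}}\subseteq\mathcal{F}$ such that (1) for any distinct indices $i_1,\dots,i_d\in\mathbb{N}$, there is no hyperplane intersecting every one of $B_{i_1},\dots,B_{i_d}$ and $\{p\}$; and (2) for any distinct indices $i_1,\dots,i_{d+1}\in\mathbb{N}$, there is no hyperplane intersecting every one of $B_{i_1},\dots,B_{i_{d+1}}$.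
   Context: A hyperplane in $\mathbb{R}^d$ is an affine subspace of dimension $d-1$ (a point when $d=1$). A finite hyperplane transversal of a family $\mathcal{G}$ of sets is a finite set of hyperplanes such that every set in $\mathcal{G}$ intersects at least one of them. $B(p,\epsilon)$ denotes the open ball of radius $\epsilon$ centered at $p$. For a ray $\vec{r}=\{p+tv\mid t\ge0\}$ and $n\in\mathbb{N}$, let $U_n=\{u\in\mathbb{R}^d\mid \langle u,v\rangle=1,\ \|u-v\|\le\tfrac1n\}$, $C_n=\{p+tu\mid t\ge0,\ u\in U_n\}$ (the closed circular cone with apex $p$ through the disc of radius $1/n$ centered at $p+v$ perpendicular to $v$), and $R(\vec{r},n):=C_n\cap B(p,\tfrac1n)$. *)

theory Defs
  imports "HOL-Analysis.Analysis"
begin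

definition hyperplane :: "(real ^ 'd) set \<Rightarrow> bool" where
  "hyperplane H \<longleftrightarrow> affine H \<and> aff_dim H = int CARD('d) - 1"

definition has_finite_hyperplane_transversal :: "(real ^ 'd) set set \<Rightarrow> bool" where
  "has_finite_hyperplane_transversal \<G> \<longleftrightarrow>
     (\<exists>T. finite T \<and> (\<forall>H\<in>T. hyperplane H) \<and> (\<forall>B\<in>\<G>. \<exists>H\<in>T. B \<inter> H \<noteq> {}))"

text \<open>In the following three definitions the ray is given by its apex \<open>p\<close> and its unit direction
  \<open>v\<close>. They are meaningful only for \<open>n > 0\<close>: since \<open>1 / 0 = 0\<close>, the index \<open>n = 0\<close> would give an
  empty region.\<close>

definition cone_disc :: "real ^ 'd \<Rightarrow> nat \<Rightarrow> (real ^ 'd) set" where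
  "cone_disc v n = {u. u \<bullet> v = 1 \<and> norm (u - v) \<le> 1 / real n}"

definition ray_cone :: "real ^ 'd \<Rightarrow> real ^ 'd \<Rightarrow> nat \<Rightarrow> (real ^ 'd) set" where
  "ray_cone p v n = {p + t *\<^sub>R u | t u. t \<ge> 0 \<and> u \<in> cone_disc v n}"

definition ray_region :: "real ^ 'd \<Rightarrow> real ^ 'd \<Rightarrow> nat \<Rightarrow> (real ^ 'd) set" where
  "ray_region p v n = ray_cone p v n \<inter> ball p (1 / real n)"

end

theory Submission
  imports Defs
begin

text \<open>Take an ultrafilter on \<open>\<F>\<close> that contains, for every hyperplane, the sets missing it, and for
  every \<open>n\<close> the sets inside the \<open>n\<close>-th region. A connected set missing a hyperplane lies on one
  side of it, so the ultrafilter assigns a sign to every nonzero linear functional \<open>\<langle>a, x - p\<rangle>\<close> and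
  thereby makes the space of functionals a totally ordered vector space. Such a space has a
  lexicographic basis: positive functionals, each infinitesimal relative to the preceding one, and
  all infinitesimal relative to the constant \<open>1\<close>. Hence \<open>\<F>\<close> contains sets on which \<open>1\<close> and the
  basis functionals decay arbitrarily fast. If each set of a sequence is chosen with a decay rate
  tiny compared with the previous sets, the linear system expressing that a hyperplane meets
  \<open>d + 1\<close> of the sets (or \<open>d\<close> of them and \<open>p\<close>) is triangular up to small errors and has only the
  trivial solution.\<close>

section \<open>Extending filters to ultrafilters\<close>

text \<open>Zorn's lemma on the proper filters below \<open>F\<close> gives a minimal one, that is,
  one with the most eventual properties. If \<open>\<not> P\<close> is not eventual, restricting to
  \<open>P\<close> stays proper, so by minimality \<open>P\<close> was already eventual.\<close>

lemma ultrafilter_exists: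
  fixes F :: "'a filter"
  assumes "F \<noteq> bot"
  obtains U where "U \<le> F" "U \<noteq> bot"
    "\<forall>P. eventually P U \<or> eventually (\<lambda>x. \<not> P x) U"
proof -
  let ?A = "{G. G \<le> F \<and> G \<noteq> bot}"
  have "\<exists>m\<in>?A. \<forall>a\<in>?A. m \<ge> a \<longrightarrow> a = m"
  proof (rule predicate_Zorn)
    show "partial_order_on ?A (relation_of (\<ge>) ?A)"
      by (rule partial_order_on_relation_ofI) auto
  next
    fix C assume "C \<in> Chains (relation_of (\<ge>) ?A)"
    then have sub: "C \<subseteq> ?A" and chain: "\<And>a b. a \<in> C \<Longrightarrow> b \<in> C \<Longrightarrow> a \<le> b \<or> b \<le> a"
      by (auto simp: Chains_def relation_of_def)
    show "\<exists>u\<in>?A. \<forall>a\<in>C. a \<ge> u"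
    proof (cases "C = {}")
      case True
      then show ?thesis using assms by auto
    next
      case False
      \<comment> \<open>A property eventual for the infimum of a nonempty chain is already eventual
        for a member of it, so properness passes to the infimum.\<close>
      have "eventually P (Inf C) \<longleftrightarrow> (\<exists>b\<in>C. eventually P b)" for P
        using False by (rule eventually_Inf_base) (metis chain inf.absorb1 inf.absorb2 order_refl)
      then have "Inf C \<noteq> bot"
        using sub by (auto simp: trivial_limit_def)
      moreover have "Inf C \<le> F"
        using False sub by (auto intro: Inf_lower2)
      ultimately show ?thesis
        by (intro bexI[of _ "Inf C"]) (auto intro: Inf_lower)
    qed
  qed
  then obtain U where U: "U \<le> F" "U \<noteq> bot"
    and maxU: "\<And>G. G \<le> U \<Longrightarrow> G \<noteq> bot \<Longrightarrow> G = U"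
    by (smt (verit) mem_Collect_eq order_trans)
  have "eventually P U" if "\<not> eventually (\<lambda>x. \<not> P x) U" for P
  proof -
    have "inf U (principal {x. P x}) \<noteq> bot"
      using that by (simp add: trivial_limit_def eventually_inf_principal)
    then have "inf U (principal {x. P x}) = U"
      by (intro maxU) auto
    moreover have "eventually P (inf U (principal {x. P x}))"
      by (simp add: eventually_inf_principal)
    ultimately show ?thesis by simp
  qed
  with U show thesis using that by blast
qed

section \<open>Totally ordered vector spaces and lexicographic bases\<close>

text \<open>\<open>pos\<close> is the strict positive cone of a total order compatible with the
  vector space structure: \<open>a < b\<close> means \<open>pos (b - a)\<close>. Antisymmetry comes
  from \<open>pos_add\<close> and \<open>not_pos_0\<close>.\<close>

locale ordered_space =
  fixes pos :: "'v::euclidean_space \<Rightarrow> bool"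
  assumes pos_add: "pos a \<Longrightarrow> pos b \<Longrightarrow> pos (a + b)"
    and pos_scaleR: "pos a \<Longrightarrow> c > 0 \<Longrightarrow> pos (c *\<^sub>R a)"
    and not_pos_0: "\<not> pos 0"
    and pos_total: "a \<noteq> 0 \<Longrightarrow> pos a \<or> pos (- a)"
begin

text \<open>The elements infinitesimal relative to \<open>w\<close>, that is
  \<open>\<bar>a\<bar> < e w\<close> for every real \<open>e > 0\<close>. The absolute value is
  spelled out as two positivity conditions.\<close>

definition negligible_to :: "'v \<Rightarrow> 'v set" where
  "negligible_to w = {a. \<forall>e>0. pos (e *\<^sub>R w - a) \<and> pos (e *\<^sub>R w + a)}"

lemma subspace_negligible_to:
  assumes "pos w"
  shows "subspace (negligible_to w)"
  unfolding subspace_def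
proof (intro conjI ballI allI)
  show "0 \<in> negligible_to w"
    using assms by (auto simp: negligible_to_def pos_scaleR)
next
  fix a b assume ab: "a \<in> negligible_to w" "b \<in> negligible_to w"
  show "a + b \<in> negligible_to w"
    unfolding negligible_to_def
  proof (intro CollectI allI impI)
    fix e :: real assume "e > 0"
    then have h: "pos ((e/2) *\<^sub>R w - a)" "pos ((e/2) *\<^sub>R w + a)"
      "pos ((e/2) *\<^sub>R w - b)" "pos ((e/2) *\<^sub>R w + b)"
      using ab by (auto simp: negligible_to_def)
    have "e *\<^sub>R w = (e/2) *\<^sub>R w + (e/2) *\<^sub>R w"
      by (simp flip: scaleR_left_distrib)
    then show "pos (e *\<^sub>R w - (a + b)) \<and> pos (e *\<^sub>R w + (a + b))"
      using pos_add[OF h(1,3)] pos_add[OF h(2,4)] by (simp add: algebra_simps)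
  qed
next
  fix c :: real and a assume a: "a \<in> negligible_to w"
  show "c *\<^sub>R a \<in> negligible_to w"
  proof (cases "c = 0")
    case True
    then show ?thesis
      using assms by (auto simp: negligible_to_def pos_scaleR)
  next
    case False
    show ?thesis
      unfolding negligible_to_def
    proof (intro CollectI allI impI)
      fix e :: real assume "e > 0"
      then have h: "pos ((e / \<bar>c\<bar>) *\<^sub>R w - a)" "pos ((e / \<bar>c\<bar>) *\<^sub>R w + a)"
        using a False by (auto simp: negligible_to_def)
      show "pos (e *\<^sub>R w - c *\<^sub>R a) \<and> pos (e *\<^sub>R w + c *\<^sub>R a)"
        using pos_scaleR[OF h(1), of "\<bar>c\<bar>"] pos_scaleR[OF h(2), of "\<bar>c\<bar>"] False
        by (cases "c > 0") (auto simp: algebra_simps)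
    qed
  qed
qed

lemma not_negligible_to_self: "pos w \<Longrightarrow> w \<notin> negligible_to w"
  using not_pos_0 unfolding negligible_to_def by (metis (mono_tags, lifting) cancel_comm_monoid_add_class.diff_cancel mem_Collect_eq scaleR_one zero_less_one)

text \<open>The elements whose absolute value is below some real multiple of \<open>w\<close>, so
  that their Archimedean class is at most that of \<open>w\<close>.\<close>

definition dominated :: "'v \<Rightarrow> 'v set" where
  "dominated w = {a. \<exists>C>0. pos (C *\<^sub>R w - a) \<and> pos (C *\<^sub>R w + a)}"

lemma dominatedI: "C > 0 \<Longrightarrow> pos (C *\<^sub>R w - a) \<Longrightarrow> pos (C *\<^sub>R w + a) \<Longrightarrow> a \<in> dominated w"
  unfolding dominated_def by blast

lemma dominatedE:
  assumes "a \<in> dominated w"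
  obtains C where "C > 0" "pos (C *\<^sub>R w - a)" "pos (C *\<^sub>R w + a)"
  using assms unfolding dominated_def by blast

lemma subspace_dominated:
  assumes "pos w"
  shows "subspace (dominated w)"
  unfolding subspace_def
proof (intro conjI ballI allI)
  show "0 \<in> dominated w"
    using assms by (intro dominatedI[of 1]) auto
next
  fix a b assume "a \<in> dominated w" "b \<in> dominated w"
  then obtain A B where h: "A > 0" "pos (A *\<^sub>R w - a)" "pos (A *\<^sub>R w + a)"
      "B > 0" "pos (B *\<^sub>R w - b)" "pos (B *\<^sub>R w + b)"
    by (auto elim!: dominatedE)
  from pos_add[OF h(2,5)] pos_add[OF h(3,6)] h(1,4) show "a + b \<in> dominated w"
    by (intro dominatedI[of "A + B"]) (simp_all add: algebra_simps)
next
  fix c :: real and a assume "a \<in> dominated w"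
  then obtain A where h: "A > 0" "pos (A *\<^sub>R w - a)" "pos (A *\<^sub>R w + a)"
    by (rule dominatedE)
  show "c *\<^sub>R a \<in> dominated w"
  proof (cases "c = 0")
    case True
    then show ?thesis
      using assms by (intro dominatedI[of 1]) auto
  next
    case False
    have "pos (\<bar>c\<bar> *\<^sub>R (A *\<^sub>R w - a))" "pos (\<bar>c\<bar> *\<^sub>R (A *\<^sub>R w + a))"
      using False by (auto intro: pos_scaleR h)
    then have "pos ((\<bar>c\<bar> * A) *\<^sub>R w - c *\<^sub>R a) \<and> pos ((\<bar>c\<bar> * A) *\<^sub>R w + c *\<^sub>R a)"
      by (cases "c > 0") (auto simp: scaleR_diff_right scaleR_add_right)
    moreover have "\<bar>c\<bar> * A > 0"
      using False h(1) by simp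
    ultimately show ?thesis by (blast intro: dominatedI)
  qed
qed

lemma dominatedI_less:
  assumes "pos a" "pos (w - a)"
  shows "a \<in> dominated w"
proof (rule dominatedI)
  have "pos ((w - a) + a + a)"
    using assms by (intro pos_add)
  then show "pos (1 *\<^sub>R w + a)" by simp
qed (use assms in auto)

lemma self_dominated: "pos w \<Longrightarrow> w \<in> dominated w"
  using pos_add[of w w] pos_add[of "w + w" w] by (intro dominatedI[of 2]) (simp_all add: scaleR_2)

lemma dominated_mono:
  assumes "pos (t - w)"
  shows "dominated w \<subseteq> dominated t"
proof
  fix a assume "a \<in> dominated w"
  then obtain C where C: "C > 0" "pos (C *\<^sub>R w - a)" "pos (C *\<^sub>R w + a)"
    by (rule dominatedE)
  have "pos (C *\<^sub>R (t - w))"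
    using assms C(1) by (rule pos_scaleR)
  from pos_add[OF this C(2)] pos_add[OF this C(3)] show "a \<in> dominated t"
    by (intro dominatedI[OF C(1)]) (simp_all add: scaleR_diff_right)
qed

text \<open>The order is total, so a finite set has an element of largest absolute value, and this
  absolute value dominates all the others. A positive element of \<open>W\<close> starts the
  induction.\<close>

lemma dominating_element:
  assumes "finite S" "S \<subseteq> W" "subspace W" "W \<noteq> {0}"
  shows "\<exists>w\<in>W. pos w \<and> S \<subseteq> dominated w"
  using assms(1,2)
proof induction
  case empty
  obtain a where "a \<in> W" "a \<noteq> 0"
    using assms(3,4) subspace_0 by blast
  then show ?case
    using pos_total[of a] subspace_neg[OF assms(3)] by auto
next
  case (insert s S)
  then obtain w where w: "w \<in> W" "pos w" and dom: "S \<subseteq> dominated w"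
    by auto
  \<comment> \<open>Here \<open>t\<close> plays the role of the absolute value of \<open>s\<close>;
    the new dominating element is the larger of \<open>t\<close> and \<open>w\<close>.\<close>
  have step: ?case if t: "t \<in> W" "pos t" "s = t \<or> s = - t" for t
  proof -
    have s: "s \<in> dominated u" if "pos u" "t \<in> dominated u" for u
      using t(3) that subspace_neg[OF subspace_dominated] by blast
    consider "pos (t - w)" | "t = w" | "pos (w - t)"
      using pos_total[of "t - w"] by auto
    then show ?thesis
    proof cases
      case 1
      then show ?thesis
        using t dom dominated_mono s[OF t(2) self_dominated] by blast
    next
      case 2
      then show ?thesis
        using w dom s[OF w(2)] self_dominated by blast
    next
      case 3
      then show ?thesis
        using w dom s[OF w(2)] dominatedI_less[OF t(2)] by blast
    qed
  qed
  consider "s = 0" | "pos s" | "pos (- s)"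
    using pos_total by blast
  then show ?case
  proof cases
    case 1
    then show ?thesis
      using w dom subspace_0[OF subspace_dominated] by blast
  next
    case 2
    then show ?thesis using step[of s] insert.prems by auto
  next
    case 3
    then show ?thesis using step[of "- s"] insert.prems subspace_neg[OF assms(3)] by auto
  qed
qed

text \<open>The coefficient is the standard part of \<open>a / w\<close>: the supremum of the reals
  \<open>c\<close> with \<open>c w < a\<close>, which exists because \<open>a\<close> lies between
  \<open>- C w\<close> and \<open>C w\<close>.\<close>

lemma leading_coefficient:
  assumes "pos w" "pos (C *\<^sub>R w - a)" "pos (C *\<^sub>R w + a)"
  shows "\<exists>c. a - c *\<^sub>R w \<in> negligible_to w"
proof -
  define X where "X = {c. pos (a - c *\<^sub>R w)}"
  have up: "c \<le> C" if "c \<in> X" for c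
  proof (rule ccontr)
    assume "\<not> c \<le> C"
    then have "pos ((c - C) *\<^sub>R w)"
      using assms(1) by (intro pos_scaleR) auto
    moreover have "pos ((a - c *\<^sub>R w) + (C *\<^sub>R w - a))"
      using that assms(2) by (intro pos_add) (auto simp: X_def)
    ultimately have "pos ((c - C) *\<^sub>R w + ((a - c *\<^sub>R w) + (C *\<^sub>R w - a)))"
      by (rule pos_add)
    then show False
      using not_pos_0 by (simp add: algebra_simps)
  qed
  then have bdd: "bdd_above X"
    by (rule bdd_aboveI)
  have ne: "- C \<in> X"
    using assms(3) by (simp add: X_def add.commute)
  let ?c = "Sup X"
  have "pos (e *\<^sub>R w - (a - ?c *\<^sub>R w)) \<and> pos (e *\<^sub>R w + (a - ?c *\<^sub>R w))" if "e > 0" for e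
  proof
    have "?c + e/2 \<notin> X"
      using cSup_upper[OF _ bdd, of "?c + e/2"] that by auto
    \<comment> \<open>Just above the supremum the difference is zero or negative; the remaining half
      of \<open>e\<close> makes the inequality strict in both cases.\<close>
    then have h: "a - (?c + e/2) *\<^sub>R w = 0 \<or> pos (- (a - (?c + e/2) *\<^sub>R w))"
      using pos_total[of "a - (?c + e/2) *\<^sub>R w"] unfolding X_def by blast
    have h': "pos ((e/2) *\<^sub>R w)"
      using assms(1) that by (intro pos_scaleR) auto
    have eq: "e *\<^sub>R w - (a - ?c *\<^sub>R w) = (e/2) *\<^sub>R w + - (a - (?c + e/2) *\<^sub>R w)"
    proof -
      have "e *\<^sub>R w = (e/2) *\<^sub>R w + (e/2) *\<^sub>R w"
        by (simp flip: scaleR_left_distrib)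
      then show ?thesis by (simp add: algebra_simps)
    qed
    show "pos (e *\<^sub>R w - (a - ?c *\<^sub>R w))"
      unfolding eq using h
    proof
      assume "a - (?c + e/2) *\<^sub>R w = 0"
      with h' show "pos ((e/2) *\<^sub>R w + - (a - (?c + e/2) *\<^sub>R w))"
        by (simp only: minus_zero add_0_right)
    qed (rule pos_add[OF h'])
  next
    have "?c - e < ?c" using that by simp
    then obtain x where x: "x \<in> X" "?c - e < x"
      using less_cSupE[of "?c - e" X] ne by blast
    have "pos ((x - (?c - e)) *\<^sub>R w)"
      using assms(1) x by (intro pos_scaleR) auto
    with x(1) have "pos ((a - x *\<^sub>R w) + (x - (?c - e)) *\<^sub>R w)"
      by (auto simp: X_def intro: pos_add)
    then show "pos (e *\<^sub>R w + (a - ?c *\<^sub>R w))"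
      by (simp add: algebra_simps)
  qed
  then show ?thesis
    unfolding negligible_to_def by blast
qed

text \<open>Induction on the dimension. If \<open>w\<close> dominates a spanning set, it dominates
  \<open>W\<close>, and subtracting leading coefficients splits \<open>W\<close> into the line of
  \<open>w\<close> and the elements infinitesimal relative to \<open>w\<close>. The basis of the
  latter subspace follows \<open>w\<close> in the list.\<close>

lemma lexicographic_basis:
  assumes "subspace W"
  shows "\<exists>ws. length ws = dim W \<and> span (set ws) = W \<and> (\<forall>w\<in>set ws. pos w) \<and>
    sorted_wrt (\<lambda>a b. b \<in> negligible_to a) ws"
  using assms
proof (induction "dim W" arbitrary: W rule: less_induct)
  case less
  show ?case
  proof (cases "W = {0}")
    case True
    then show ?thesis by (intro exI[of _ "[]"]) auto
  next
    case False
    obtain S where S: "S \<subseteq> W" "finite S" "W \<subseteq> span S"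
      using basis_exists[of W] finiteI_independent by metis
    obtain w where w: "w \<in> W" "pos w"
      and dom: "S \<subseteq> dominated w"
      using dominating_element[OF S(2,1) less.prems False] by blast
    have domW: "W \<subseteq> dominated w"
      using S(3) span_minimal[OF dom subspace_dominated[OF w(2)]] by blast
    define V where "V = W \<inter> negligible_to w"
    have V: "subspace V"
      unfolding V_def by (intro subspace_inter less.prems subspace_negligible_to w)
    have span: "span (insert w V) = W"
    proof
      show "span (insert w V) \<subseteq> W"
        using w less.prems by (intro span_minimal) (auto simp: V_def)
      show "W \<subseteq> span (insert w V)"
      proof
        fix a assume a: "a \<in> W"
        obtain c where c: "a - c *\<^sub>R w \<in> negligible_to w"
          using a domW leading_coefficient[OF w(2)] by (blast elim: dominatedE)
        have "a - c *\<^sub>R w \<in> V"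
          unfolding V_def using a c w less.prems
          by (auto intro: subspace_diff subspace_scale)
        then show "a \<in> span (insert w V)"
          by (auto simp: span_insert intro: span_base)
      qed
    qed
    \<comment> \<open>As \<open>w\<close> is not infinitesimal relative to itself, passing to
      \<open>V\<close> lowers the dimension by exactly one.\<close>
    have "w \<notin> span V"
      using V not_negligible_to_self[OF w(2)] by (simp add: span_eq_iff[THEN iffD2] V_def)
    then have dim: "dim W = dim V + 1"
      using dim_insert[of w V] span by (metis dim_span)
    then obtain ws where ws: "length ws = dim V" "span (set ws) = V" "\<forall>w\<in>set ws. pos w"
      "sorted_wrt (\<lambda>a b. b \<in> negligible_to a) ws"
      using less.hyps[OF _ V] by auto
    have "span (set (w # ws)) = W"
      using ws(2) span V by (simp add: span_insert span_eq_iff[THEN iffD2])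
    moreover have "set ws \<subseteq> V"
      using ws(2) span_superset by blast
    ultimately show ?thesis
      using ws w dim by (intro exI[of _ "w # ws"]) (auto simp: V_def)
  qed
qed

end

section \<open>Graded linear systems and rapidly decaying sequences\<close>

text \<open>Row \<open>k\<close> of the system makes \<open>\<alpha> k\<close> small compared with the largest coefficient: the entries
  right of the diagonal are small, and left of it the coefficients are already known to be small.\<close>
lemma graded_system_trivial:
  fixes y :: "nat \<Rightarrow> nat \<Rightarrow> real"
  assumes sol: "\<And>k. k < m \<Longrightarrow> (\<Sum>l<m. \<alpha> l * y k l) = 0"
    and pos: "\<And>k l. k < m \<Longrightarrow> l < m \<Longrightarrow> y k l > 0"
    and right: "\<And>k l. k < l \<Longrightarrow> l < m \<Longrightarrow> y k l \<le> e k * y k k"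
    and left: "\<And>k l. l < k \<Longrightarrow> k < m \<Longrightarrow> y k l \<le> D k * y k k"
    and gap: "\<And>k l. l < k \<Longrightarrow> k < m \<Longrightarrow> N * e l * D k \<le> e k"
    and e: "\<And>k. k < m \<Longrightarrow> 0 < e k \<and> N * e k < 1"
    and N: "real m \<le> N"
    and "k < m"
  shows "\<alpha> k = 0"
proof -
  define M where "M = Max ((\<lambda>k. \<bar>\<alpha> k\<bar>) ` {..<m})"
  have M: "\<bar>\<alpha> k\<bar> \<le> M" if "k < m" for k
    using that by (auto simp: M_def)
  then have M0: "M \<ge> 0"
    using \<open>k < m\<close> abs_ge_zero order_trans by blast
  \<comment> \<open>Strong induction on the row: the bounds for earlier coefficients carry the
    factor \<open>e l\<close>, which by \<open>gap\<close> absorbs the possibly large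
    \<open>D k\<close>.\<close>
  have small: "\<bar>\<alpha> k\<bar> \<le> N * e k * M" if "k < m" for k
    using that
  proof (induction k rule: less_induct)
    case (less k)
    have bound: "\<bar>\<alpha> l * y k l\<bar> \<le> e k * M * y k k" if l: "l < m" "l \<noteq> k" for l
    proof (cases "k < l")
      case True
      then have "\<bar>\<alpha> l\<bar> * y k l \<le> M * (e k * y k k)"
        using l less.prems M M0 right pos[of k l] by (intro mult_mono) (auto intro: less_imp_le)
      then show ?thesis
        using pos[of k l] l less.prems by (simp add: abs_mult mult_ac)
    next
      case False
      with l have lk: "l < k" by auto
      then have "\<bar>\<alpha> l\<bar> * y k l \<le> (N * e l * M) * (D k * y k k)"
        using l less.prems less.IH[of l] M0 e[of l] N left pos[of k l]
        by (intro mult_mono) (auto intro: less_imp_le)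
      also have "\<dots> = (N * e l * D k) * (M * y k k)"
        by simp
      also have "\<dots> \<le> e k * (M * y k k)"
        using gap[OF lk less.prems] M0 pos[of k k] less.prems
        by (intro mult_right_mono) (auto intro: less_imp_le)
      finally show ?thesis
        using pos[of k l] l less.prems by (simp add: abs_mult mult_ac)
    qed
    have "\<alpha> k * y k k = - (\<Sum>l\<in>{..<m} - {k}. \<alpha> l * y k l)"
      using sol[OF less.prems] less.prems sum.remove[of "{..<m}" k "\<lambda>l. \<alpha> l * y k l"] by auto
    then have "\<bar>\<alpha> k\<bar> * y k k \<le> (\<Sum>l\<in>{..<m} - {k}. \<bar>\<alpha> l * y k l\<bar>)"
      using pos[OF less.prems less.prems] sum_abs[of "\<lambda>l. \<alpha> l * y k l" "{..<m} - {k}"]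
      by (simp add: abs_mult)
    also have "\<dots> \<le> real (card ({..<m} - {k})) * (e k * M * y k k)"
      by (rule sum_bounded_above) (use bound in auto)
    also have "\<dots> \<le> N * (e k * M * y k k)"
      using N M0 e[OF less.prems] pos[OF less.prems less.prems] less.prems
      by (intro mult_right_mono) auto
    finally show ?case
      using pos[OF less.prems less.prems] by (simp add: mult_ac)
  qed
  have "M \<in> (\<lambda>k. \<bar>\<alpha> k\<bar>) ` {..<m}"
    unfolding M_def using \<open>k < m\<close> by (intro Max_in) auto
  then obtain j where j: "j < m" "M = \<bar>\<alpha> j\<bar>" by auto
  \<comment> \<open>At an index attaining the maximum, the factor \<open>N * e j < 1\<close> leaves
    no other value.\<close>
  have "M = 0"
  proof (rule ccontr)
    assume "M \<noteq> 0"
    with M0 e[OF j(1)] have "N * e j * M < 1 * M"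
      by (intro mult_strict_right_mono) auto
    with small[OF j(1)] j(2) show False by auto
  qed
  with M[OF \<open>k < m\<close>] show ?thesis by auto
qed

text \<open>The ratios \<open>g l / g k\<close> are continuous, hence bounded on a compact set, and
  there are finitely many of them. The constant controls the entries left of the diagonal in the
  graded system.\<close>

lemma compact_ratio_bound:
  fixes g :: "nat \<Rightarrow> 'a::topological_space \<Rightarrow> real"
  assumes "compact B" and cont: "\<And>k. k < m \<Longrightarrow> continuous_on B (g k)"
    and pos: "\<And>k x. k < m \<Longrightarrow> x \<in> B \<Longrightarrow> g k x > 0"
  obtains D where "D \<ge> 1" "\<And>k l x. k < m \<Longrightarrow> l < m \<Longrightarrow> x \<in> B \<Longrightarrow> g l x \<le> D * g k x"
proof -
  have "\<exists>D. \<forall>x\<in>B. g l x / g k x \<le> D" if "k < m" "l < m" for k l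
  proof -
    have "continuous_on B (\<lambda>x. g l x / g k x)"
      using that pos[of k] by (intro continuous_on_divide cont) fastforce+
    from compact_imp_bounded[OF compact_continuous_image[OF this assms(1)]]
    obtain D where "\<forall>x\<in>B. \<bar>g l x / g k x\<bar> \<le> D"
      by (auto simp: bounded_iff)
    then show ?thesis by (meson abs_le_D1)
  qed
  then obtain D where D: "\<And>k l x. k < m \<Longrightarrow> l < m \<Longrightarrow> x \<in> B \<Longrightarrow> g l x / g k x \<le> D k l"
    by metis
  \<comment> \<open>Inserting \<open>1\<close> yields \<open>E \<ge> 1\<close> and keeps the set
    nonempty when \<open>m = 0\<close>.\<close>
  define E where "E = Max (insert 1 ((\<lambda>(k, l). D k l) ` ({..<m} \<times> {..<m})))"
  show thesis
  proof (rule that)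
    show "E \<ge> 1" by (simp add: E_def)
    fix k l x assume h: "k < m" "l < m" "x \<in> B"
    have "D k l \<le> E"
      unfolding E_def using h by (intro Max_ge) auto
    with D[OF h] have "g l x / g k x \<le> E" by linarith
    then show "g l x \<le> E * g k x"
      using pos[OF h(1,3)] by (simp add: divide_le_eq)
  qed
qed

text \<open>With \<open>g 0\<close> the constant \<open>1\<close> and the remaining \<open>g k\<close> linear in \<open>x - p\<close>, the offset \<open>s = 0\<close>
  covers arbitrary hyperplanes and \<open>s = 1\<close> those through \<open>p\<close>.\<close>
lemma generic_sequence:
  fixes g :: "nat \<Rightarrow> 'a::topological_space \<Rightarrow> real"
  assumes comp: "\<And>B. B \<in> \<F> \<Longrightarrow> compact B"
    and cont: "\<And>k. k < m \<Longrightarrow> continuous_on UNIV (g k)"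
    and graded: "\<And>e::real. e > 0 \<Longrightarrow> \<exists>B\<in>\<F>. \<forall>x\<in>B. (\<forall>k<m. g k x > 0) \<and>
        (\<forall>k l. k < l \<longrightarrow> l < m \<longrightarrow> g l x \<le> e * g k x)"
  obtains B :: "nat \<Rightarrow> 'a set" where "range B \<subseteq> \<F>"
    "\<forall>s q I \<alpha>. s + q \<le> m \<longrightarrow> finite I \<longrightarrow> card I = q \<longrightarrow>
        (\<forall>n\<in>I. \<exists>x\<in>B n. (\<Sum>l<q. \<alpha> l * g (s + l) x) = 0) \<longrightarrow> (\<forall>k<q. \<alpha> k = 0)"
proof -
  \<comment> \<open>The ratio bound \<open>D\<close> depends on the set chosen for the rate
    \<open>e\<close>, so each rate of the sequence has to be fixed after the preceding set.\<close>
  have "\<exists>B D. B \<in> \<F> \<and> D \<ge> 1 \<and> (\<forall>x\<in>B. (\<forall>k<m. g k x > 0) \<and>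
        (\<forall>k l. k < l \<longrightarrow> l < m \<longrightarrow> g l x \<le> e * g k x) \<and>
        (\<forall>k<m. \<forall>l<m. g l x \<le> D * g k x))" if e: "e > 0" for e :: real
  proof -
    obtain B where B: "B \<in> \<F>" "\<forall>x\<in>B. (\<forall>k<m. g k x > 0) \<and>
        (\<forall>k l. k < l \<longrightarrow> l < m \<longrightarrow> g l x \<le> e * g k x)"
      using graded[OF e] by blast
    obtain D where "D \<ge> 1" "\<And>k l x. k < m \<Longrightarrow> l < m \<Longrightarrow> x \<in> B \<Longrightarrow> g l x \<le> D * g k x"
      using compact_ratio_bound[OF comp[OF B(1)], of m g] B(2) cont continuous_on_subset
      by (metis subset_UNIV)
    with B show ?thesis by blast
  qed
  then obtain Bf Df where BD: "\<And>e::real. e > 0 \<Longrightarrow> Bf e \<in> \<F> \<and> Df e \<ge> (1::real) \<and>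
      (\<forall>x\<in>Bf e. (\<forall>k<m. g k x > 0) \<and>
        (\<forall>k l. k < l \<longrightarrow> l < m \<longrightarrow> g l x \<le> e * g k x) \<and>
        (\<forall>k<m. \<forall>l<m. g l x \<le> Df e * g k x))"
    by metis
  define N where "N = real m + 1"
  have N: "N \<ge> 1" by (simp add: N_def)
  \<comment> \<open>The recursion turns the gap condition into an equality for consecutive indices;
    since the rates decrease, it then holds for all later ones. The start \<open>1 / (2 * N)\<close>
    ensures \<open>N * e n < 1\<close> throughout.\<close>
  define e where "e = rec_nat (1 / (2 * N)) (\<lambda>_ x. x / (N * Df x))"
  have e0: "e 0 = 1 / (2 * N)" and eS: "e (Suc n) = e n / (N * Df (e n))" for n
    by (simp_all add: e_def)
  have epos: "e n > 0" for n
  proof (induction n)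
    case (Suc n)
    then show ?case using BD[of "e n"] N by (simp add: eS)
  qed (use N in \<open>simp add: e0\<close>)
  note BDe = BD[OF epos]
  have gap1: "N * e (Suc n) * Df (e n) = e n" for n
    using BDe[of n] N by (simp add: eS)
  have "e (Suc n) \<le> e n" for n
  proof -
    have "1 * 1 \<le> N * Df (e n)"
      using BDe[of n] N by (intro mult_mono) auto
    then show ?thesis
      using epos[of n] by (simp add: eS divide_le_eq)
  qed
  then have dec: "e n \<le> e i" if "i \<le> n" for i n
    using that by (rule lift_Suc_antimono_le)
  have gap: "N * e n * Df (e i) \<le> e i" if "i < n" for i n
  proof -
    have "N * e n * Df (e i) \<le> N * e (Suc i) * Df (e i)"
      using dec[of "Suc i" n] that N BDe[of i] by (intro mult_right_mono mult_left_mono) auto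
    with gap1 show ?thesis by simp
  qed
  have lt1: "N * e n < 1" for n
  proof -
    have "N * e n \<le> N * e 0"
      using dec[of 0 n] N by (intro mult_left_mono) auto
    then show ?thesis using N by (simp add: e0)
  qed
  show thesis
  proof (rule that[of "\<lambda>n. Bf (e n)"])
    show "range (\<lambda>n. Bf (e n)) \<subseteq> \<F>" using BDe by auto
  next
    show "\<forall>s q I \<alpha>. s + q \<le> m \<longrightarrow> finite I \<longrightarrow> card I = q \<longrightarrow>
      (\<forall>n\<in>I. \<exists>x\<in>Bf (e n). (\<Sum>l<q. \<alpha> l * g (s + l) x) = 0) \<longrightarrow> (\<forall>k<q. \<alpha> k = 0)"
    proof (intro allI impI)
      fix s q I and \<alpha> :: "nat \<Rightarrow> real" and k
      assume sq: "s + q \<le> m" and I: "finite I" "card I = q" and k: "k < q"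
        and meet: "\<forall>n\<in>I. \<exists>x\<in>Bf (e n). (\<Sum>l<q. \<alpha> l * g (s + l) x) = 0"
      \<comment> \<open>The rows list \<open>I\<close> in decreasing order: row \<open>0\<close>
        belongs to the largest index, hence to the smallest rate. The gap condition needs the rates
        of earlier rows to be tiny compared with those of later rows.\<close>
      define \<iota> where "\<iota> j = sorted_list_of_set I ! (q - 1 - j)" for j
      have \<iota>I: "\<iota> j \<in> I" if "j < q" for j
        using that I nth_mem[of "q - 1 - j" "sorted_list_of_set I"] by (simp add: \<iota>_def)
      have \<iota>_less: "\<iota> j < \<iota> i" if "i < j" "j < q" for i j
        using that I sorted_wrt_nth_less[OF strict_sorted_list_of_set, of "q - 1 - j" "q - 1 - i" I]
        by (simp add: \<iota>_def)
      obtain x where x: "\<And>n. n \<in> I \<Longrightarrow> x n \<in> Bf (e n)"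
        and sol: "\<And>n. n \<in> I \<Longrightarrow> (\<Sum>l<q. \<alpha> l * g (s + l) (x n)) = 0"
        using meet by metis
      have mem: "x (\<iota> j) \<in> Bf (e (\<iota> j))" if "j < q" for j
        using that \<iota>I x by blast
      show "\<alpha> k = 0"
      proof (rule graded_system_trivial[where y = "\<lambda>j l. g (s + l) (x (\<iota> j))" and m = q
            and e = "\<lambda>j. e (\<iota> j)" and D = "\<lambda>j. Df (e (\<iota> j))" and N = N])
        show "real q \<le> N" using sq by (simp add: N_def)
        show "0 < g (s + l) (x (\<iota> j))" if "j < q" "l < q" for j l
          using BDe[of "\<iota> j"] mem[of j] that sq by simp
        show "g (s + l) (x (\<iota> j)) \<le> e (\<iota> j) * g (s + j) (x (\<iota> j))" if "j < l" "l < q" for j l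
          using BDe[of "\<iota> j"] mem[of j] that sq by simp
        show "g (s + l) (x (\<iota> j)) \<le> Df (e (\<iota> j)) * g (s + j) (x (\<iota> j))" if "l < j" "j < q" for j l
          using BDe[of "\<iota> j"] mem[of j] that sq by simp
        show "N * e (\<iota> l) * Df (e (\<iota> j)) \<le> e (\<iota> j)" if "l < j" "j < q" for j l
          using gap \<iota>_less that by blast
      qed (use sol \<iota>I k lt1 epos in auto)
    qed
  qed
qed

section \<open>Hyperplanes and finite transversals\<close>

lemma hyperplane_eq:
  fixes H :: "(real ^ 'd) set"
  assumes "hyperplane H"
  obtains a b where "a \<noteq> 0" "H = {x. a \<bullet> x = b}"
proof -
  have hull: "affine hull H = H" and dim: "aff_dim H = int (DIM(real ^ 'd) - 1)"
    using assms by (simp_all add: hyperplane_def affine_hull_eq of_nat_diff Suc_le_eq)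
  obtain a b where "a \<noteq> 0" "affine hull H = {x. a \<bullet> x = b}"
    using iffD1[OF aff_dim_eq_hyperplane dim] by blast
  then show thesis
    using that unfolding hull by blast
qed

lemma hyperplane_inner: "a \<noteq> 0 \<Longrightarrow> hyperplane {x. a \<bullet> x = b}"
  by (simp add: hyperplane_def affine_hyperplane aff_dim_hyperplane)

lemma has_finite_hyperplane_transversal_subset:
  "has_finite_hyperplane_transversal \<G> \<Longrightarrow> \<H> \<subseteq> \<G> \<Longrightarrow> has_finite_hyperplane_transversal \<H>"
  unfolding has_finite_hyperplane_transversal_def by (meson subsetD)

lemma has_finite_hyperplane_transversal_Un:
  assumes "has_finite_hyperplane_transversal \<G>" "has_finite_hyperplane_transversal \<H>"
  shows "has_finite_hyperplane_transversal (\<G> \<union> \<H>)"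
proof -
  obtain S where "finite S" "\<forall>H\<in>S. hyperplane H" "\<forall>B\<in>\<G>. \<exists>H\<in>S. B \<inter> H \<noteq> {}"
    using assms(1) unfolding has_finite_hyperplane_transversal_def by (elim exE conjE)
  moreover obtain T where "finite T" "\<forall>H\<in>T. hyperplane H" "\<forall>B\<in>\<H>. \<exists>H\<in>T. B \<inter> H \<noteq> {}"
    using assms(2) unfolding has_finite_hyperplane_transversal_def by (elim exE conjE)
  ultimately have "finite (S \<union> T)" "\<forall>H\<in>S \<union> T. hyperplane H"
    "\<forall>B\<in>\<G> \<union> \<H>. \<exists>H\<in>S \<union> T. B \<inter> H \<noteq> {}"
    by (auto simp only: finite_Un ball_Un bex_Un)
  then show ?thesis
    unfolding has_finite_hyperplane_transversal_def by metis
qed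

lemma ray_region_antimono:
  assumes "1 \<le> m" "m \<le> n"
  shows "ray_region p v n \<subseteq> ray_region p v m"
proof -
  have "1 / real n \<le> 1 / real m"
    using assms by (simp add: frac_le)
  then show ?thesis
    unfolding ray_region_def ray_cone_def cone_disc_def by fastforce
qed

section \<open>The ultrafilter on the family and its order on functionals\<close>

text \<open>A property is \<open>big\<close> if its exceptions inside some region have a finite
  transversal. Unions of transversals and nested regions make the big properties a filter, and the
  hypothesis says exactly that this filter is proper. Any ultrafilter refining it works.\<close>

lemma compatible_ultrafilter:
  fixes \<F> :: "(real ^ 'd) set set" and p v :: "real ^ 'd"
  assumes "\<And>n::nat. n \<ge> 1 \<Longrightarrow> \<not> has_finite_hyperplane_transversal {B \<in> \<F>. B \<subseteq> ray_region p v n}"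
  obtains U where "U \<noteq> bot" "\<forall>P. eventually P U \<or> eventually (\<lambda>B. \<not> P B) U"
    "eventually (\<lambda>B. B \<in> \<F>) U"
    "\<forall>n\<ge>1. eventually (\<lambda>B. B \<subseteq> ray_region p v n) U"
    "\<forall>H. hyperplane H \<longrightarrow> eventually (\<lambda>B. B \<inter> H = {}) U"
proof -
  define big where "big P \<longleftrightarrow> (\<exists>n\<ge>1. has_finite_hyperplane_transversal
      {B \<in> \<F>. B \<subseteq> ray_region p v n \<and> \<not> P B})" for P
  have filt: "is_filter big"
  proof
    show "big (\<lambda>_. True)"
      unfolding big_def has_finite_hyperplane_transversal_def by (auto intro: exI[of _ "{}"])
  next
    fix P Q assume "big P" "big Q"
    then obtain m n where mn: "m \<ge> 1" "n \<ge> 1"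
      and t: "has_finite_hyperplane_transversal {B \<in> \<F>. B \<subseteq> ray_region p v m \<and> \<not> P B}"
        "has_finite_hyperplane_transversal {B \<in> \<F>. B \<subseteq> ray_region p v n \<and> \<not> Q B}"
      unfolding big_def by blast
    have "ray_region p v (max m n) \<subseteq> ray_region p v m" "ray_region p v (max m n) \<subseteq> ray_region p v n"
      using mn by (simp_all add: ray_region_antimono)
    then have "has_finite_hyperplane_transversal
        {B \<in> \<F>. B \<subseteq> ray_region p v (max m n) \<and> \<not> (P B \<and> Q B)}"
      by (intro has_finite_hyperplane_transversal_subset[OF has_finite_hyperplane_transversal_Un[OF t]])
        blast
    with mn show "big (\<lambda>x. P x \<and> Q x)"
      unfolding big_def by (intro exI[of _ "max m n"]) auto
  next
    fix P Q :: "(real ^ 'd) set \<Rightarrow> bool" assume "\<forall>x. P x \<longrightarrow> Q x" "big P"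
    then show "big Q"
      unfolding big_def by (blast intro: has_finite_hyperplane_transversal_subset)
  qed
  define F where "F = Abs_filter big"
  have evF: "eventually P F \<longleftrightarrow> big P" for P
    unfolding F_def using filt by (rule eventually_Abs_filter)
  have "F \<noteq> bot"
    using assms by (simp add: trivial_limit_def evF big_def)
  obtain U where U: "U \<le> F" "U \<noteq> bot" "\<forall>P. eventually P U \<or> eventually (\<lambda>B. \<not> P B) U"
    by (rule ultrafilter_exists[OF \<open>F \<noteq> bot\<close>])
  \<comment> \<open>The last three claims are instances: \<open>T\<close> is empty where the region
    leaves no exceptions, and \<open>T = {H}\<close> catches the sets that meet
    \<open>H\<close>.\<close>
  have evU: "eventually P U" if "n \<ge> 1" "finite T" "\<forall>H\<in>T. hyperplane H"
    "\<And>B. B \<in> \<F> \<Longrightarrow> B \<subseteq> ray_region p v n \<Longrightarrow> \<not> P B \<Longrightarrow> \<exists>H\<in>T. B \<inter> H \<noteq> {}" for P n T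
  proof -
    have "has_finite_hyperplane_transversal {B \<in> \<F>. B \<subseteq> ray_region p v n \<and> \<not> P B}"
      unfolding has_finite_hyperplane_transversal_def using that by (intro exI[of _ T]) auto
    with \<open>n \<ge> 1\<close> have "big P"
      unfolding big_def by blast
    then show ?thesis using U(1) by (auto simp: le_filter_def evF)
  qed
  show thesis
  proof (rule that[OF U(2,3)])
    show "eventually (\<lambda>B. B \<in> \<F>) U" by (rule evU[of 1 "{}"]) auto
    show "\<forall>n\<ge>1. eventually (\<lambda>B. B \<subseteq> ray_region p v n) U"
    proof (intro allI impI)
      fix n :: nat assume "n \<ge> 1"
      then show "eventually (\<lambda>B. B \<subseteq> ray_region p v n) U"
        by (rule evU[of n "{}"]) auto
    qed
    show "\<forall>H. hyperplane H \<longrightarrow> eventually (\<lambda>B. B \<inter> H = {}) U"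
    proof (intro allI impI)
      fix H :: "(real ^ 'd) set" assume "hyperplane H"
      then show "eventually (\<lambda>B. B \<inter> H = {}) U"
        by (intro evU[of 1 "{H}"]) auto
    qed
  qed
qed

text \<open>The list is a lexicographic basis for the order induced by the ultrafilter. For a given
  \<open>e\<close>, the required inequalities amount to finitely many eventual properties, so a
  single member of \<open>\<F>\<close> has them all.\<close>

lemma graded_functionals:
  fixes \<F> :: "(real ^ 'd) set set" and p v :: "real ^ 'd"
  assumes conn: "\<And>B. B \<in> \<F> \<Longrightarrow> connected B" and ne: "{} \<notin> \<F>"
    and big: "\<And>n::nat. n \<ge> 1 \<Longrightarrow> \<not> has_finite_hyperplane_transversal {B \<in> \<F>. B \<subseteq> ray_region p v n}"
  obtains ws :: "(real ^ 'd) list" where "length ws = CARD('d)" "span (set ws) = UNIV"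
    "\<And>e::real. e > 0 \<Longrightarrow> \<exists>B\<in>\<F>. \<forall>x\<in>B. (\<forall>k<CARD('d). 0 < ws ! k \<bullet> (x - p)) \<and>
      (\<forall>k<CARD('d). ws ! k \<bullet> (x - p) \<le> e) \<and>
      (\<forall>k l. k < l \<longrightarrow> l < CARD('d) \<longrightarrow> ws ! l \<bullet> (x - p) \<le> e * (ws ! k \<bullet> (x - p)))"
proof -
  obtain U where U: "U \<noteq> bot" "\<forall>P. eventually P U \<or> eventually (\<lambda>B. \<not> P B) U"
    and evF: "eventually (\<lambda>B. B \<in> \<F>) U"
    and evR: "\<forall>n\<ge>1. eventually (\<lambda>B. B \<subseteq> ray_region p v n) U"
    and evH: "\<forall>H. hyperplane H \<longrightarrow> eventually (\<lambda>B. B \<inter> H = {}) U"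
    by (rule compatible_ultrafilter[OF big])
  define pos where "pos a \<longleftrightarrow> eventually (\<lambda>B. \<forall>x\<in>B. 0 < a \<bullet> (x - p)) U" for a
  interpret ordered_space pos
  proof
    fix a b assume "pos a" "pos b"
    then show "pos (a + b)"
      unfolding pos_def by eventually_elim (simp add: inner_add_left add_pos_pos)
  next
    fix a and c :: real assume "pos a" "c > 0"
    then show "pos (c *\<^sub>R a)"
      unfolding pos_def by (elim eventually_mono) auto
  next
    \<comment> \<open>Positivity of the zero functional on a set forces the set to be empty, which
      \<open>{} \<notin> \<F>\<close> excludes.\<close>
    show "\<not> pos 0"
    proof
      assume "pos 0"
      with evF have "eventually (\<lambda>_. False) U"
        unfolding pos_def by eventually_elim (use ne in auto)
      with U(1) show False by (simp add: trivial_limit_def)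
    qed
  next
    fix a assume a: "a \<noteq> (0 :: real ^ 'd)"
    \<comment> \<open>Almost every set misses the hyperplane through \<open>p\<close> with normal
      \<open>a\<close>; by connectedness it lies strictly on one side. The ultrafilter then selects
      one of the two signs.\<close>
    have sign: "eventually (\<lambda>B. (\<forall>x\<in>B. 0 < a \<bullet> (x - p)) \<or> (\<forall>x\<in>B. a \<bullet> (x - p) < 0)) U"
      using evF evH[rule_format, OF hyperplane_inner[OF a, of "a \<bullet> p"]]
    proof eventually_elim
      case (elim B)
      show ?case
      proof (rule ccontr)
        assume "\<not> ?thesis"
        then obtain x y where xy: "x \<in> B" "y \<in> B" "a \<bullet> x \<le> a \<bullet> p" "a \<bullet> p \<le> a \<bullet> y"
          by (force simp: inner_diff_right not_less)
        obtain z where "z \<in> B" "a \<bullet> z = a \<bullet> p"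
          using connected_ivt_hyperplane[OF conn[OF elim(1)] xy] by blast
        with elim(2) show False by blast
      qed
    qed
    show "pos a \<or> pos (- a)"
    proof (cases "pos a")
      case False
      then have "eventually (\<lambda>B. \<not> (\<forall>x\<in>B. 0 < a \<bullet> (x - p))) U"
        using U(2) unfolding pos_def by blast
      with sign have "pos (- a)"
        unfolding pos_def by eventually_elim auto
      then show ?thesis ..
    qed simp
  qed
  obtain ws where ws: "length ws = CARD('d)" "span (set ws) = UNIV" "\<forall>w\<in>set ws. pos w"
    "sorted_wrt (\<lambda>a b. b \<in> negligible_to a) ws"
    using lexicographic_basis[of "UNIV :: (real ^ 'd) set"] by auto
  show thesis
  proof (rule that[OF ws(1,2)])
    fix e :: real assume e: "e > 0"
    have 1: "eventually (\<lambda>B. \<forall>k\<in>{..<CARD('d)}. \<forall>x\<in>B. 0 < ws ! k \<bullet> (x - p)) U"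
      using ws(1,3) by (intro eventually_ball_finite) (auto simp: pos_def)
    have 2: "eventually (\<lambda>B. \<forall>k\<in>{..<CARD('d)}. \<forall>x\<in>B. ws ! k \<bullet> (x - p) \<le> e) U"
    proof (intro eventually_ball_finite ballI)
      fix k
      \<comment> \<open>Inside the ball of radius \<open>1 / n\<close> around \<open>p\<close>,
        Cauchy-Schwarz bounds the functional by \<open>norm (ws ! k) / n\<close>, which is below
        \<open>e\<close>.\<close>
      obtain n :: nat where n: "norm (ws ! k) / e < real n"
        using reals_Archimedean2 by blast
      then have n1: "n \<ge> 1"
        using e by (cases n) (auto simp: divide_less_0_iff not_less[symmetric])
      show "eventually (\<lambda>B. \<forall>x\<in>B. ws ! k \<bullet> (x - p) \<le> e) U"
        using evR[rule_format, OF n1]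
      proof eventually_elim
        case (elim B)
        show ?case
        proof
          fix x assume "x \<in> B"
          with elim have "norm (x - p) \<le> 1 / real n"
            by (auto simp: ray_region_def dist_norm norm_minus_commute)
          then have "norm (ws ! k) * norm (x - p) \<le> norm (ws ! k) * (1 / real n)"
            by (intro mult_left_mono) auto
          also have "\<dots> \<le> e"
            using n n1 e by (simp add: field_simps)
          finally show "ws ! k \<bullet> (x - p) \<le> e"
            using norm_cauchy_schwarz[of "ws ! k" "x - p"] by linarith
        qed
      qed
    qed auto
    have 3: "eventually (\<lambda>B. \<forall>k\<in>{..<CARD('d)}. \<forall>l\<in>{k<..<CARD('d)}. \<forall>x\<in>B.
        ws ! l \<bullet> (x - p) \<le> e * (ws ! k \<bullet> (x - p))) U"
    proof (intro eventually_ball_finite ballI)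
      fix k l assume "l \<in> {k<..<CARD('d)}"
      then have "ws ! l \<in> negligible_to (ws ! k)"
        using ws(1) sorted_wrt_nth_less[OF ws(4), of k l] by auto
      then have "pos (e *\<^sub>R ws ! k - ws ! l)"
        using e by (auto simp: negligible_to_def)
      then show "eventually (\<lambda>B. \<forall>x\<in>B. ws ! l \<bullet> (x - p) \<le> e * (ws ! k \<bullet> (x - p))) U"
        unfolding pos_def by (elim eventually_mono) (auto simp: inner_diff_left less_imp_le)
    qed auto
    from evF 1 2 3 have "eventually (\<lambda>B. B \<in> \<F> \<and> (\<forall>x\<in>B. (\<forall>k<CARD('d). 0 < ws ! k \<bullet> (x - p)) \<and>
      (\<forall>k<CARD('d). ws ! k \<bullet> (x - p) \<le> e) \<and>
      (\<forall>k l. k < l \<longrightarrow> l < CARD('d) \<longrightarrow> ws ! l \<bullet> (x - p) \<le> e * (ws ! k \<bullet> (x - p))))) U"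
      by eventually_elim auto
    from eventually_happens'[OF U(1) this]
    show "\<exists>B\<in>\<F>. \<forall>x\<in>B. (\<forall>k<CARD('d). 0 < ws ! k \<bullet> (x - p)) \<and>
      (\<forall>k<CARD('d). ws ! k \<bullet> (x - p) \<le> e) \<and>
      (\<forall>k l. k < l \<longrightarrow> l < CARD('d) \<longrightarrow> ws ! l \<bullet> (x - p) \<le> e * (ws ! k \<bullet> (x - p)))"
      by blast
  qed
qed

section \<open>From hyperplanes to linear systems\<close>

text \<open>A spanning list as long as the dimension has no repetitions, so coefficients attached to
  elements can be reindexed by position.\<close>

lemma span_list_coefficients:
  fixes ws :: "'a::euclidean_space list"
  assumes "length ws = DIM('a)" "span (set ws) = UNIV"
  obtains \<beta> where "a = (\<Sum>k<DIM('a). \<beta> k *\<^sub>R ws ! k)"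
proof -
  have "DIM('a) \<le> card (set ws)"
    using dim_le_card[of UNIV "set ws"] assms(2) by simp
  then have "distinct ws"
    using assms(1) card_length[of ws] by (intro card_distinct) auto
  obtain u where "a = (\<Sum>w\<in>set ws. u w *\<^sub>R w)"
    using assms(2) span_finite[of "set ws"] by (metis (no_types, lifting) List.finite_set UNIV_I imageE)
  also have "\<dots> = (\<Sum>k<DIM('a). u (ws ! k) *\<^sub>R ws ! k)"
    using sum.reindex_bij_betw[OF bij_betw_nth[OF \<open>distinct ws\<close> refl refl], of "\<lambda>w. u w *\<^sub>R w"]
    by (simp add: assms(1))
  finally show thesis by (rule that)
qed

theorem theorem4:
  fixes \<F> :: "(real ^ 'd) set set" and p v :: "real ^ 'd"
  assumes "\<And>B. B \<in> \<F> \<Longrightarrow> compact B \<and> connected B"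
    and "\<not> has_finite_hyperplane_transversal \<F>"
    and "norm v = 1"
    and "\<And>n::nat. n \<ge> 1 \<Longrightarrow> \<not> has_finite_hyperplane_transversal {B \<in> \<F>. B \<subseteq> ray_region p v n}"
  shows "\<exists>B :: nat \<Rightarrow> (real ^ 'd) set. range B \<subseteq> \<F> \<and>
    (\<forall>i :: nat \<Rightarrow> nat. inj_on i {1..CARD('d)} \<longrightarrow>
       \<not> (\<exists>H. hyperplane H \<and> (\<forall>j\<in>{1..CARD('d)}. H \<inter> B (i j) \<noteq> {}) \<and> H \<inter> {p} \<noteq> {})) \<and>
    (\<forall>i :: nat \<Rightarrow> nat. inj_on i {1..CARD('d) + 1} \<longrightarrow>
       \<not> (\<exists>H. hyperplane H \<and> (\<forall>j\<in>{1..CARD('d) + 1}. H \<inter> B (i j) \<noteq> {})))"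
proof (cases "{} \<in> \<F>")
  case True
  \<comment> \<open>The constant empty sequence is met by no hyperplane; positive dimension
    guarantees that at least one index is tested.\<close>
  have "1 \<le> CARD('d)" by (simp add: Suc_le_eq)
  with True show ?thesis
    by (intro exI[of _ "\<lambda>_. {}"]) (auto simp: not_le)
next
  case False
  let ?d = "CARD('d)"
  obtain ws :: "(real ^ 'd) list" where ws: "length ws = ?d" "span (set ws) = UNIV"
    and graded: "\<And>e::real. e > 0 \<Longrightarrow> \<exists>B\<in>\<F>. \<forall>x\<in>B. (\<forall>k<?d. 0 < ws ! k \<bullet> (x - p)) \<and>
      (\<forall>k<?d. ws ! k \<bullet> (x - p) \<le> e) \<and>
      (\<forall>k l. k < l \<longrightarrow> l < ?d \<longrightarrow> ws ! l \<bullet> (x - p) \<le> e * (ws ! k \<bullet> (x - p)))"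
    using graded_functionals[OF conjunct2[OF assms(1)] False assms(4)] by metis
  \<comment> \<open>The shift by one makes room for the constant \<open>1\<close> at index
    \<open>0\<close>. The bound \<open>\<le> e\<close> on the functionals becomes their grading
    relative to \<open>g 0\<close>.\<close>
  define g where "g k x = (case k of 0 \<Rightarrow> 1 | Suc j \<Rightarrow> ws ! j \<bullet> (x - p))" for k x
  have cont: "continuous_on UNIV (g k)" for k
    unfolding g_def by (cases k) (auto intro!: continuous_intros)
  have graded_g: "\<exists>B\<in>\<F>. \<forall>x\<in>B. (\<forall>k<?d + 1. g k x > 0) \<and>
      (\<forall>k l. k < l \<longrightarrow> l < ?d + 1 \<longrightarrow> g l x \<le> e * g k x)" if "e > 0" for e :: real
  proof -
    from graded[OF that] obtain B where "B \<in> \<F>" and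
      B: "\<And>x k. x \<in> B \<Longrightarrow> k < ?d \<Longrightarrow> 0 < ws ! k \<bullet> (x - p)"
      "\<And>x k. x \<in> B \<Longrightarrow> k < ?d \<Longrightarrow> ws ! k \<bullet> (x - p) \<le> e"
      "\<And>x k l. x \<in> B \<Longrightarrow> k < l \<Longrightarrow> l < ?d \<Longrightarrow> ws ! l \<bullet> (x - p) \<le> e * (ws ! k \<bullet> (x - p))"
      by metis
    then show ?thesis
      by (intro bexI[of _ B]) (auto simp: g_def split: nat.split)
  qed
  obtain B :: "nat \<Rightarrow> (real ^ 'd) set" where B: "range B \<subseteq> \<F>" and
    gen: "\<forall>s q I \<alpha>. s + q \<le> ?d + 1 \<longrightarrow> finite I \<longrightarrow> card I = q \<longrightarrow>
      (\<forall>n\<in>I. \<exists>x\<in>B n. (\<Sum>l<q. \<alpha> l * g (s + l) x) = 0) \<longrightarrow> (\<forall>k<q. \<alpha> k = 0)"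
    by (rule generic_sequence[OF conjunct1[OF assms(1)] cont graded_g])
  have zero: "a = 0" if a: "a = (\<Sum>k<?d. \<beta> k *\<^sub>R ws ! k)" and "\<And>k. k < ?d \<Longrightarrow> \<beta> k = 0" for a \<beta>
    using that by simp
  have expand: "(\<Sum>k<?d. \<beta> k * g (Suc k) x) = a \<bullet> x - a \<bullet> p" if "a = (\<Sum>k<?d. \<beta> k *\<^sub>R ws ! k)" for a \<beta> x
  proof -
    have "a \<bullet> (x - p) = (\<Sum>k<?d. \<beta> k * g (Suc k) x)"
      by (simp add: that inner_sum_left g_def)
    then show ?thesis by (simp add: inner_diff_right)
  qed
  have through_p: False if i: "inj_on i {1..?d}" and H: "hyperplane H" "H \<inter> {p} \<noteq> {}"
    and meet: "\<forall>j\<in>{1..?d}. H \<inter> B (i j) \<noteq> {}" for i :: "nat \<Rightarrow> nat" and H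
  proof -
    obtain a b where ab: "a \<noteq> 0" "H = {x. a \<bullet> x = b}"
      using hyperplane_eq[OF H(1)] .
    obtain \<beta> where \<beta>: "a = (\<Sum>k<?d. \<beta> k *\<^sub>R ws ! k)"
      using span_list_coefficients[of ws a] ws by auto
    \<comment> \<open>Since \<open>p \<in> H\<close> gives \<open>b = a \<bullet> p\<close>, the
      equation of \<open>H\<close> has no constant term, so offset \<open>1\<close> with
      \<open>?d\<close> unknowns applies.\<close>
    have "\<beta> k = 0" if "k < ?d" for k
    proof (rule gen[rule_format, of 1 ?d "i ` {1..?d}"])
      fix n assume "n \<in> i ` {1..?d}"
      then obtain x where "x \<in> B n" "a \<bullet> x = b"
        using meet ab(2) by blast
      then show "\<exists>x\<in>B n. (\<Sum>l<?d. \<beta> l * g (1 + l) x) = 0"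
        using expand[OF \<beta>, of x] H(2) ab(2) by auto
    qed (use i that in \<open>auto simp: card_image\<close>)
    from zero[OF \<beta> this] ab(1) show False by simp
  qed
  have general: False if i: "inj_on i {1..?d + 1}" and H: "hyperplane H"
    and meet: "\<forall>j\<in>{1..?d + 1}. H \<inter> B (i j) \<noteq> {}" for i :: "nat \<Rightarrow> nat" and H
  proof -
    obtain a b where ab: "a \<noteq> 0" "H = {x. a \<bullet> x = b}"
      using hyperplane_eq[OF H(1)] .
    obtain \<beta> where \<beta>: "a = (\<Sum>k<?d. \<beta> k *\<^sub>R ws ! k)"
      using span_list_coefficients[of ws a] ws by auto
    \<comment> \<open>These are the coefficients of \<open>a \<bullet> x - b = (a \<bullet> p - b) +
      a \<bullet> (x - p)\<close> with respect to the functions \<open>g k\<close>.\<close>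
    define \<alpha> where "\<alpha> k = (case k of 0 \<Rightarrow> a \<bullet> p - b | Suc j \<Rightarrow> \<beta> j)" for k
    have \<alpha>: "\<alpha> k = 0" if "k < ?d + 1" for k
    proof (rule gen[rule_format, of 0 "?d + 1" "i ` {1..?d + 1}"])
      fix n assume "n \<in> i ` {1..?d + 1}"
      then obtain x where x: "x \<in> B n" "a \<bullet> x = b"
        using meet ab(2) by blast
      have "(\<Sum>l<?d + 1. \<alpha> l * g (0 + l) x) = (a \<bullet> p - b) + (\<Sum>k<?d. \<beta> k * g (Suc k) x)"
        by (simp add: \<alpha>_def g_def sum.lessThan_Suc_shift del: sum.lessThan_Suc)
      with x expand[OF \<beta>, of x] show "\<exists>x\<in>B n. (\<Sum>l<?d + 1. \<alpha> l * g (0 + l) x) = 0"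
        by (intro bexI[of _ x]) auto
    qed (use i that in \<open>auto simp: card_image\<close>)
    have "\<beta> k = 0" if "k < ?d" for k
      using \<alpha>[of "Suc k"] that by (simp add: \<alpha>_def)
    from zero[OF \<beta> this] ab(1) show False by simp
  qed
  show ?thesis
    using B through_p general by (intro exI[of _ B]) blast
qed

end
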